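(* Let $(X,f)$ be a topological dynamical system, i.e. $X$ is a compact metric space and $f:X\to X$ is continuous, such that $f$ is Lipschitz, and suppose that $\overline{\mathcal{M}^{co}(f)}=\mathcal{M}(f)$. Then $$\{\mu\in\mathcal{M}(f): h_\mu(f)=0\}$$ is a residual subset of $\mathcal{M}(f)$.
   Context: $\mathcal{M}(f)$ is the space of $f$-invariant Borel probability measures on $X$ endowed with the topology of weak convergence (convergence of integrals of bounded continuous functions). $\mathcal{M}^{co}(f)$ is the set of $f$-invariant periodic measures, i.e. measures of the form $\mu_x=\frac{1}{k_x}\sum_{i=0}^{k_x-1}\delta_{f^i(x)}$, where $x\in X$ is an $f$-periodic point of period $k_x$ and $\delta_y$ is the Dirac measure at $y$; the closure is taken in $\mathcal{M}(f)$. $h_\mu(f)$ is the metric (Kolmogorov–Sinai) entropy. A set is residual if it contains a countable intersection of dense open sets. *)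

theory Defs
  imports "HOL-Probability.Probability"
begin

text \<open>The phase space is the whole type \<open>'a\<close>; its compactness is a hypothesis of the theorem.\<close>

section \<open>Invariant measures and the weak topology\<close>

definition borel_prob_measures :: "'a::metric_space measure set" where
  "borel_prob_measures = {\<mu>. sets \<mu> = sets borel \<and> prob_space \<mu>}"

definition invariant_measures :: "('a::metric_space \<Rightarrow> 'a) \<Rightarrow> 'a measure set" where
  "invariant_measures f = {\<mu> \<in> borel_prob_measures. distr \<mu> borel f = \<mu>}"

text \<open>The topology of convergence of integrals of bounded continuous functions, that is, the coarsest
  topology for which all the maps \<open>\<mu> \<mapsto> \<integral>\<phi> d\<mu>\<close> with \<open>\<phi>\<close> bounded and continuous are continuous.\<close>

definition weak_topology :: "'a::metric_space measure topology" where
  "weak_topology = topology_generated_by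
     {{\<mu> \<in> borel_prob_measures. (\<integral>x. \<phi> x \<partial>\<mu>) \<in> U} | (\<phi> :: 'a \<Rightarrow> real) U.
        continuous_on UNIV \<phi> \<and> bounded (range \<phi>) \<and> open U}"

definition invariant_topology :: "('a::metric_space \<Rightarrow> 'a) \<Rightarrow> 'a measure topology" where
  "invariant_topology f = subtopology weak_topology (invariant_measures f)"

lemma topspace_weak_topology: "topspace weak_topology = borel_prob_measures"
proof -
  have "borel_prob_measures \<in>
     {{\<mu> \<in> borel_prob_measures. (\<integral>x. \<phi> x \<partial>\<mu>) \<in> U} | (\<phi> :: 'a \<Rightarrow> real) U.
        continuous_on UNIV \<phi> \<and> bounded (range \<phi>) \<and> open U}"
    by (intro CollectI exI[of _ "\<lambda>_. 0"] exI[of _ UNIV]) auto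
  then show ?thesis
    unfolding weak_topology_def topology_generated_by_topspace by blast
qed

lemma topspace_invariant_topology: "topspace (invariant_topology f) = invariant_measures f"
  by (auto simp: invariant_topology_def topspace_weak_topology invariant_measures_def)

section \<open>Periodic measures\<close>

definition periodic_point :: "('a \<Rightarrow> 'a) \<Rightarrow> 'a \<Rightarrow> bool" where
  "periodic_point f x \<longleftrightarrow> (\<exists>k>0. (f ^^ k) x = x)"

definition period :: "('a \<Rightarrow> 'a) \<Rightarrow> 'a \<Rightarrow> nat" where
  "period f x = (LEAST k. k > 0 \<and> (f ^^ k) x = x)"

text \<open>\<open>return borel y\<close> is the Dirac measure at \<open>y\<close>.\<close>

definition orbit_measure :: "('a::metric_space \<Rightarrow> 'a) \<Rightarrow> 'a \<Rightarrow> 'a measure" where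
  "orbit_measure f x = measure_of UNIV (sets borel)
     (\<lambda>A. (\<Sum>i<period f x. emeasure (return borel ((f ^^ i) x)) A) / of_nat (period f x))"

definition periodic_measures :: "('a::metric_space \<Rightarrow> 'a) \<Rightarrow> 'a measure set" where
  "periodic_measures f = {orbit_measure f x | x. periodic_point f x}"

lemma sets_orbit_measure: "sets (orbit_measure f x) = sets borel"
proof -
  have "sets (measure_of UNIV (sets borel) m) = sets (borel :: 'a measure)" for m
    using sets.sets_measure_of_eq[of "borel :: 'a measure"] by simp
  then show ?thesis
    by (simp add: orbit_measure_def)
qed

lemma emeasure_orbit_measure:
  assumes "A \<in> sets borel"
  shows "emeasure (orbit_measure f x) A =
    (\<Sum>i<period f x. emeasure (return borel ((f ^^ i) x)) A) / of_nat (period f x)"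
proof (rule emeasure_measure_of[OF orbit_measure_def])
  show "countably_additive (sets (orbit_measure f x))
     (\<lambda>A. (\<Sum>i<period f x. emeasure (return borel ((f ^^ i) x)) A) / of_nat (period f x))"
    unfolding countably_additive_def sets_orbit_measure
  proof (intro allI impI)
    fix B :: "nat \<Rightarrow> 'a set"
    assume B: "range B \<subseteq> sets borel" "disjoint_family B" "\<Union> (range B) \<in> sets borel"
    have "(\<Sum>n. emeasure (return borel y) (B n)) = emeasure (return borel y) (\<Union> (range B))" for y
      using B by (intro suminf_emeasure) auto
    then show "(\<Sum>n. (\<Sum>i<period f x. emeasure (return borel ((f ^^ i) x)) (B n)) / of_nat (period f x))
      = (\<Sum>i<period f x. emeasure (return borel ((f ^^ i) x)) (\<Union> (range B))) / of_nat (period f x)"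
      by (simp add: ennreal_suminf_divide suminf_sum)
  qed
qed (use assms in \<open>auto simp: positive_def sets_orbit_measure\<close>)

section \<open>Metric entropy\<close>

definition finite_measurable_partition :: "'a::metric_space set set \<Rightarrow> bool" where
  "finite_measurable_partition P \<longleftrightarrow> finite P \<and> P \<subseteq> sets borel \<and> partition_on UNIV P"

text \<open>Null sets contribute \<open>0\<close>, since \<open>ln 0 = 0\<close>.\<close>

definition partition_entropy :: "'a measure \<Rightarrow> 'a set set \<Rightarrow> real" where
  "partition_entropy \<mu> P = - (\<Sum>A\<in>P. measure \<mu> A * ln (measure \<mu> A))"

text \<open>The join of the partitions \<open>f\<^sup>-\<^sup>i P\<close> with \<open>i < n\<close>; it is the trivial partition for \<open>n = 0\<close>.
  Preimages may contain the empty set when \<open>f\<close> is not surjective, but \<open>common_refinement\<close> drops it.\<close>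

definition dynamical_join :: "('a \<Rightarrow> 'a) \<Rightarrow> 'a set set \<Rightarrow> nat \<Rightarrow> 'a set set" where
  "dynamical_join f P n = common_refinement ((\<lambda>i. (\<lambda>A. (f ^^ i) -` A) ` P) ` {..<n})"

definition entropy_wrt_partition :: "('a \<Rightarrow> 'a) \<Rightarrow> 'a measure \<Rightarrow> 'a set set \<Rightarrow> real" where
  "entropy_wrt_partition f \<mu> P = lim (\<lambda>n. partition_entropy \<mu> (dynamical_join f P n) / real n)"

definition metric_entropy :: "('a::metric_space \<Rightarrow> 'a) \<Rightarrow> 'a measure \<Rightarrow> ereal" where
  "metric_entropy f \<mu> = (SUP P \<in> Collect finite_measurable_partition. ereal (entropy_wrt_partition f \<mu> P))"

section \<open>Residual sets\<close>

definition residual_in :: "'a topology \<Rightarrow> 'a set \<Rightarrow> bool" where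
  "residual_in T S \<longleftrightarrow> S \<subseteq> topspace T \<and>
     (\<exists>\<G>. countable \<G> \<and> (\<forall>U\<in>\<G>. openin T U \<and> T closure_of U = topspace T) \<and>
          topspace T \<inter> \<Inter>\<G> \<subseteq> S)"

end

theory Submission
  imports Defs
begin

text \<open>
  A measure \<open>\<mu>\<close> that gives mass close to \<open>1\<close> to the set of points whose first \<open>m\<close> iterates closely shadow
  a periodic orbit of period \<open>k\<close>, with \<open>m\<close> much larger than \<open>k\<close>, has small entropy: up to a small proportion of
  mistakes, the \<open>P\<close>-itinerary of length \<open>m\<close> is determined by one of only \<open>k\<close> phases, so the entropy of the
  \<open>m\<close>-th join is at most \<open>ln k\<close> plus a small multiple of \<open>m\<close>. For fixed tolerance \<open>1/n\<close>, the shadowing set is open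
  and contains the periodic orbit, so the measures giving it mass more than \<open>1 - 1/n\<close> for some periodic orbit
  form an open set containing all periodic measures, hence a dense one. Intersecting over \<open>n\<close> gives
  measures of entropy zero. All entropy estimates come from Gibbs' inequality with a suitable comparison
  distribution on words.
\<close>

section \<open>Measures of open and closed sets\<close>

text \<open>Continuity from below along the closed sets of points at distance at least
  \<open>1 / Suc n\<close> from the complement. The whole space is excluded because
  \<open>infdist x {}\<close> is \<open>0\<close> by convention.\<close>

lemma open_measure_infdist_approx:
  fixes U :: "'a::metric_space set"
  assumes "finite_measure M" and M: "sets M = sets borel" and "open U" and "U \<noteq> UNIV"
    and "c < measure M U"
  obtains d where "d > 0" and "c < measure M {x. d \<le> infdist x (- U)}"
proof -
  interpret finite_measure M by fact
  define F where "F n = {x. 1 / real (Suc n) \<le> infdist x (- U)}" for n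
  have closed: "closed (F n)" for n
    unfolding F_def by (intro closed_Collect_le continuous_intros)
  have "incseq F"
  proof (rule monoI)
    fix m n :: nat assume "m \<le> n"
    then have "1 / real (Suc n) \<le> 1 / real (Suc m)"
      by (simp add: frac_le)
    then show "F m \<subseteq> F n"
      by (auto simp: F_def)
  qed
  moreover have "(\<Union>n. F n) = U"
  proof (intro equalityI subsetI)
    fix x assume "x \<in> (\<Union>n. F n)"
    then obtain n where "1 / real (Suc n) \<le> infdist x (- U)"
      by (auto simp: F_def)
    then have "infdist x (- U) > 0"
      by (smt (verit) divide_pos_pos of_nat_0_less_iff zero_less_Suc)
    then show "x \<in> U"
      by (metis ComplI infdist_zero less_irrefl)
  next
    fix x assume "x \<in> U"
    then have "infdist x (- U) > 0"
      using assms by (intro infdist_pos_not_in_closed) auto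
    then obtain n where "1 / real (Suc n) < infdist x (- U)"
      by (metis nat_approx_posE)
    then show "x \<in> (\<Union>n. F n)"
      by (auto simp: F_def intro!: exI[of _ n])
  qed
  ultimately have "(\<lambda>n. measure M (F n)) \<longlonglongrightarrow> measure M U"
    using finite_Lim_measure_incseq[of F] closed M by (auto simp: image_subset_iff)
  then have "eventually (\<lambda>n. c < measure M (F n)) sequentially"
    using assms by (intro order_tendstoD)
  then obtain n where "c < measure M (F n)"
    by (auto simp: eventually_sequentially)
  then show ?thesis
    by (intro that[of "1 / real (Suc n)"]) (auto simp: F_def)
qed

text \<open>Inner and outer approximation are proved together so that the induction over the
  generated sigma-algebra survives complements, which swap the two.\<close>

lemma borel_closed_open_approx:
  fixes A :: "'a::metric_space set"
  assumes "finite_measure M" and M: "sets M = sets borel" and "A \<in> sets borel" and "e > 0"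
  shows "\<exists>F U. closed F \<and> open U \<and> F \<subseteq> A \<and> A \<subseteq> U \<and> measure M (U - F) < e"
proof -
  interpret finite_measure M by fact
  have "A \<in> sigma_sets UNIV {S. open S}"
    using assms by (simp add: borel_def)
  then show ?thesis
    using \<open>e > 0\<close>
  proof (induction arbitrary: e)
    case (Basic U)
    show ?case
    proof (cases "U = UNIV")
      case True
      then show ?thesis
        using Basic by (intro exI[of _ UNIV]) auto
    next
      case False
      obtain d where d: "d > 0" "measure M U - e < measure M {x. d \<le> infdist x (- U)}"
        using open_measure_infdist_approx[of M U "measure M U - e"] assms Basic False by auto
      let ?F = "{x. d \<le> infdist x (- U)}"
      have "closed ?F"
        by (intro closed_Collect_le continuous_intros)
      moreover have "?F \<subseteq> U"
        using d by (smt (verit) ComplI infdist_zero mem_Collect_eq subsetI)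
      moreover have "measure M (U - ?F) = measure M U - measure M ?F"
        using calculation Basic M by (intro finite_measure_Diff) auto
      ultimately show ?thesis
        using d Basic by (intro exI[of _ ?F] exI[of _ U]) auto
    qed
  next
    case Empty
    then show ?case by (intro exI[of _ "{}"]) auto
  next
    case (Compl A)
    from Compl.IH[OF Compl.prems] obtain F U
      where "closed F" "open U" "F \<subseteq> A" "A \<subseteq> U" "measure M (U - F) < e"
      by blast
    moreover have "- F - - U = U - F" by blast
    ultimately show ?case
      by (intro exI[of _ "- U"] exI[of _ "- F"]) (auto simp: open_Compl closed_Compl)
  next
    case (Union A)
    \<comment> \<open>The tolerances add up to \<open>e / 2\<close>, which leaves room to cut the
      union of the closed sets down to a finite one.\<close>
    have "\<exists>F U. closed F \<and> open U \<and> F \<subseteq> A n \<and> A n \<subseteq> U \<and> measure M (U - F) < e / 2 * (1 / 2) ^ Suc n" for n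
      using Union.prems by (intro Union.IH) simp
    then obtain F U where FU: "\<And>n. closed (F n)" "\<And>n. open (U n)" "\<And>n. F n \<subseteq> A n" "\<And>n. A n \<subseteq> U n"
      and small: "\<And>n. measure M (U n - F n) < e / 2 * (1 / 2) ^ Suc n"
      by metis
    have sums: "(\<lambda>n. e / 2 * (1 / 2) ^ Suc n) sums (e / 2)"
      using sums_mult[OF power_half_series, of "e / 2"] by simp
    have summable: "summable (\<lambda>n. measure M (U n - F n))"
    proof (rule summable_comparison_test[OF _ sums_summable[OF sums]], intro exI allI impI)
      show "norm (measure M (U n - F n)) \<le> e / 2 * (1 / 2) ^ Suc n" for n
        using less_imp_le[OF small] by simp
    qed
    let ?V = "\<Union>n. U n"
    have "measure M (?V - (\<Union>n. F n)) \<le> measure M (\<Union>n. U n - F n)"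
      using FU M by (intro finite_measure_mono) auto
    also have "measure M (\<Union>n. U n - F n) \<le> (\<Sum>n. measure M (U n - F n))"
      using FU M summable by (intro finite_measure_subadditive_countably) auto
    also have "\<dots> \<le> (\<Sum>n. e / 2 * (1 / 2) ^ Suc n)"
      by (rule suminf_le[OF less_imp_le[OF small] summable sums_summable[OF sums]])
    also have "\<dots> = e / 2"
      using sums by (simp add: sums_iff)
    finally have "measure M (?V - (\<Union>n. F n)) < e"
      using \<open>e > 0\<close> by simp
    \<comment> \<open>An infinite union of closed sets need not be closed; by continuity from above,
      finitely many of the \<open>F n\<close> already suffice.\<close>
    moreover have "(\<lambda>N. measure M (?V - (\<Union>n\<le>N. F n))) \<longlonglongrightarrow> measure M (\<Inter>N. ?V - (\<Union>n\<le>N. F n))"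
    proof (rule finite_Lim_measure_decseq)
      have "open ?V" "closed (\<Union>n\<le>N. F n)" for N
        using FU by (auto intro: closed_UN)
      then show "range (\<lambda>N. ?V - (\<Union>n\<le>N. F n)) \<subseteq> sets M"
        using M by (auto intro!: sets.Diff)
      show "decseq (\<lambda>N. ?V - (\<Union>n\<le>N. F n))"
        by (intro decseq_SucI) (auto intro: le_SucI)
    qed
    moreover have "(\<Inter>N. ?V - (\<Union>n\<le>N. F n)) = ?V - (\<Union>n. F n)"
      by blast
    ultimately have "eventually (\<lambda>N. measure M (?V - (\<Union>n\<le>N. F n)) < e) sequentially"
      by (auto intro: order_tendstoD)
    then obtain N where "measure M (?V - (\<Union>n\<le>N. F n)) < e"
      by (auto simp: eventually_sequentially)
    moreover have "closed (\<Union>n\<le>N. F n)" "open ?V" "(\<Union>n\<le>N. F n) \<subseteq> (\<Union>n. A n)" "(\<Union>n. A n) \<subseteq> ?V"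
      using FU by (auto intro!: closed_UN) blast+
    ultimately show ?case by blast
  qed
qed

text \<open>A continuous function squeezed between the indicators of a closed subset of
  \<open>U\<close> and of \<open>U\<close> itself provides a basic weak neighbourhood. This is the
  lower semicontinuity part of the portmanteau theorem.\<close>

lemma openin_weak_topology_measure_gt:
  fixes U :: "'a::metric_space set"
  assumes "open U"
  shows "openin weak_topology {\<mu> \<in> borel_prob_measures. c < measure \<mu> U}"
proof (cases "U = UNIV")
  case True
  have "measure \<mu> U = 1" if "\<mu> \<in> borel_prob_measures" for \<mu> :: "'a measure"
    using that True prob_space.prob_space[of \<mu>] sets_eq_imp_space_eq[of \<mu> borel]
    by (auto simp: borel_prob_measures_def)
  then have "{\<mu> \<in> borel_prob_measures. c < measure \<mu> U} = (if c < 1 then borel_prob_measures else {})"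
    by auto
  then show ?thesis
    by (metis openin_empty openin_topspace topspace_weak_topology)
next
  case False
  show ?thesis
  proof (subst openin_subopen, safe)
    fix \<mu> :: "'a measure" assume \<mu>: "\<mu> \<in> borel_prob_measures" "c < measure \<mu> U"
    then interpret prob_space \<mu> by (simp add: borel_prob_measures_def)
    have sets: "sets \<mu> = sets borel"
      using \<mu> by (simp add: borel_prob_measures_def)
    obtain d where d: "d > 0" "c < measure \<mu> {x. d \<le> infdist x (- U)}"
      using open_measure_infdist_approx[OF _ sets \<open>open U\<close> False \<mu>(2)] finite_measure_axioms by blast
    let ?F = "{x. d \<le> infdist x (- U)}"
    \<comment> \<open>A Urysohn function: \<open>1\<close> on \<open>?F\<close> and \<open>0\<close>
      outside \<open>U\<close>.\<close>
    define \<phi> where "\<phi> x = min 1 (infdist x (- U) / d)" for x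
    have cont: "continuous_on UNIV \<phi>"
      unfolding \<phi>_def using d by (intro continuous_intros) auto
    have range: "0 \<le> \<phi> x \<and> \<phi> x \<le> 1" for x
      using d by (simp add: \<phi>_def infdist_nonneg)
    have bdd: "bounded (range \<phi>)"
      using range by (intro boundedI[of _ 1]) auto
    have int: "integrable \<nu> \<phi>" if "\<nu> \<in> borel_prob_measures" for \<nu>
    proof -
      interpret \<nu>: prob_space \<nu> using that by (simp add: borel_prob_measures_def)
      have "\<phi> \<in> borel_measurable \<nu>"
        using that borel_measurable_continuous_onI[OF cont]
          measurable_cong_sets[of \<nu> borel borel borel]
        by (auto simp: borel_prob_measures_def)
      then show ?thesis
        using range by (intro \<nu>.integrable_const_bound[of _ 1]) auto
    qed
    let ?N = "{\<nu> \<in> borel_prob_measures. (\<integral>x. \<phi> x \<partial>\<nu>) \<in> {c<..}}"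
    have "openin weak_topology ?N"
      unfolding weak_topology_def using cont bdd
      by (intro topology_generated_by_Basis CollectI exI[of _ \<phi>] exI[of _ "{c<..}"]) auto
    moreover have "\<mu> \<in> ?N"
    proof -
      have F: "?F \<in> sets \<mu>"
        using sets by (auto intro!: borel_closed closed_Collect_le continuous_intros)
      then have "measure \<mu> ?F = (\<integral>x. indicator ?F x \<partial>\<mu>)"
        by simp
      also have "\<dots> \<le> (\<integral>x. \<phi> x \<partial>\<mu>)"
      proof (rule integral_mono)
        show "integrable \<mu> (indicat_real ?F)"
          using F by (intro integrable_real_indicator) (auto simp: emeasure_eq_measure)
        show "indicat_real ?F x \<le> \<phi> x" for x
          using d range[of x] by (auto simp: indicator_def \<phi>_def)
      qed (rule int[OF \<mu>(1)])
      finally show ?thesis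
        using \<mu> d by simp
    qed
    moreover have "?N \<subseteq> {\<mu> \<in> borel_prob_measures. c < measure \<mu> U}"
    proof (rule subsetI)
      fix \<nu> assume "\<nu> \<in> ?N"
      then have \<nu>: "\<nu> \<in> borel_prob_measures" "c < (\<integral>x. \<phi> x \<partial>\<nu>)" by auto
      interpret \<nu>: prob_space \<nu> using \<nu> by (simp add: borel_prob_measures_def)
      have U: "U \<in> sets \<nu>"
        using \<nu> \<open>open U\<close> by (simp add: borel_prob_measures_def)
      have "(\<integral>x. \<phi> x \<partial>\<nu>) \<le> (\<integral>x. indicator U x \<partial>\<nu>)"
      proof (rule integral_mono)
        show "integrable \<nu> (indicat_real U)"
          using U by (intro integrable_real_indicator) (auto simp: \<nu>.emeasure_eq_measure)
        show "\<phi> x \<le> indicat_real U x" for x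
          using d range[of x] by (auto simp: indicator_def \<phi>_def)
      qed (rule int[OF \<nu>(1)])
      then show "\<nu> \<in> {\<mu> \<in> borel_prob_measures. c < measure \<mu> U}"
        using U \<nu> by simp
    qed
    ultimately show "\<exists>T. openin weak_topology T \<and> \<mu> \<in> T \<and> T \<subseteq> {\<mu> \<in> borel_prob_measures. c < measure \<mu> U}"
      by blast
  qed
qed

section \<open>Gibbs' inequality\<close>

text \<open>Fekete's lemma when the infimum of the quotients is \<open>0\<close>. Division of
  \<open>n\<close> by a good \<open>m\<close> gives a part of slope at most \<open>e / 2\<close> and
  a remainder bounded independently of \<open>n\<close>.\<close>

lemma subadditive_quotient_tendsto_0:
  fixes h :: "nat \<Rightarrow> real"
  assumes nonneg: "\<And>n. 0 \<le> h n" and subadd: "\<And>m n. h (m + n) \<le> h m + h n"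
    and small: "\<And>e. e > 0 \<Longrightarrow> \<exists>m>0. h m \<le> e * real m"
  shows "(\<lambda>n. h n / real n) \<longlonglongrightarrow> 0"
proof (rule LIMSEQ_I)
  fix e :: real assume "e > 0"
  then obtain m where m: "m > 0" "h m \<le> e / 2 * real m"
    using small[of "e / 2"] by auto
  \<comment> \<open>Dominates \<open>h r\<close> for every remainder \<open>r < m\<close> at once,
    as all summands are nonnegative.\<close>
  define C where "C = (\<Sum>r<m. h r)"
  have mult: "h (q * m + r) \<le> real q * h m + h r" for q r
  proof (induction q)
    case (Suc q)
    have "h (Suc q * m + r) \<le> h m + h (q * m + r)"
      using subadd[of m "q * m + r"] by (simp add: add.assoc)
    with Suc show ?case by (simp add: distrib_right)
  qed simp
  have bound: "h n \<le> e / 2 * real n + C" for n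
  proof -
    have "h n \<le> real (n div m) * h m + h (n mod m)"
      using mult[of "n div m" "n mod m"] by simp
    also have "h (n mod m) \<le> C"
      unfolding C_def using m nonneg by (intro member_le_sum) auto
    also have "real (n div m) * h m \<le> real (n div m) * (e / 2 * real m)"
      using m by (intro mult_left_mono) auto
    also have "\<dots> = e / 2 * real (n div m * m)"
      by simp
    also have "\<dots> \<le> e / 2 * real n"
      using \<open>e > 0\<close> by (intro mult_left_mono) (auto simp del: of_nat_mult)
    finally show ?thesis by simp
  qed
  obtain N where N: "real N > 2 * C / e"
    using reals_Archimedean2 by blast
  have "norm (h n / real n - 0) < e" if "n \<ge> Suc N" for n
  proof -
    have "2 * C / e < real n"
      using N that by linarith
    then have "C < e / 2 * real n"
      using \<open>e > 0\<close> by (simp add: field_simps)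
    then have "h n < e * real n"
      using bound[of n] by (simp add: field_simps)
    then show ?thesis
      using that nonneg[of n] by (simp add: field_simps)
  qed
  then show "\<exists>N. \<forall>n\<ge>N. norm (h n / real n - 0) < e"
    by blast
qed

text \<open>Apply \<open>ln t \<le> t - 1\<close> to \<open>t = q s / p s\<close> and sum.
  Positivity of \<open>q\<close> wherever \<open>p\<close> is positive matters because
  \<open>ln 0 = 0\<close> here: such a term ought to be infinite on the right but would count as
  \<open>0\<close>.\<close>

lemma gibbs_inequality:
  fixes p q :: "'b \<Rightarrow> real"
  assumes "finite S" and p: "\<And>s. s \<in> S \<Longrightarrow> 0 \<le> p s" and q: "\<And>s. s \<in> S \<Longrightarrow> 0 \<le> q s"
    and pq: "\<And>s. s \<in> S \<Longrightarrow> p s > 0 \<Longrightarrow> q s > 0" and le: "sum q S \<le> sum p S"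
  shows "- (\<Sum>s\<in>S. p s * ln (p s)) \<le> - (\<Sum>s\<in>S. p s * ln (q s))"
proof -
  have "p s * ln (q s) - p s * ln (p s) \<le> q s - p s" if s: "s \<in> S" for s
  proof (cases "p s > 0")
    case True
    then have "ln (q s) - ln (p s) \<le> q s / p s - 1"
      using pq[OF s] ln_le_minus_one[of "q s / p s"] by (simp add: ln_div)
    then have "p s * (ln (q s) - ln (p s)) \<le> p s * (q s / p s - 1)"
      using True by (intro mult_left_mono) auto
    then show ?thesis
      using True by (simp add: algebra_simps)
  next
    case False
    then show ?thesis
      using p[OF s] q[OF s] by simp
  qed
  then have "(\<Sum>s\<in>S. p s * ln (q s) - p s * ln (p s)) \<le> (\<Sum>s\<in>S. q s - p s)"
    by (intro sum_mono)
  then show ?thesis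
    using le by (simp add: sum_subtractf)
qed

text \<open>Sums against the law of a finite-valued map become integrals, where linearity and
  pointwise bounds along orbits are available.\<close>

lemma (in finite_measure) integral_finite_valued:
  fixes c :: "'b \<Rightarrow> real"
  assumes "finite S" and T: "\<And>x. x \<in> space M \<Longrightarrow> T x \<in> S"
    and meas: "\<And>s. s \<in> S \<Longrightarrow> T -` {s} \<inter> space M \<in> sets M"
  shows "integrable M (\<lambda>x. c (T x))"
    and "(\<integral>x. c (T x) \<partial>M) = (\<Sum>s\<in>S. measure M (T -` {s} \<inter> space M) * c s)"
proof -
  have eq: "c (T x) = (\<Sum>s\<in>S. indicator (T -` {s} \<inter> space M) x * c s)" if "x \<in> space M" for x
  proof -
    have "(\<Sum>s\<in>S. indicator (T -` {s} \<inter> space M) x * c s) = (\<Sum>s\<in>S. if s = T x then c s else 0)"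
      using that by (intro sum.cong) (auto simp: indicator_def)
    then show ?thesis
      using T[OF that] \<open>finite S\<close> by simp
  qed
  have int: "integrable M (\<lambda>x. indicator (T -` {s} \<inter> space M) x * c s)" if "s \<in> S" for s
    using meas[OF that] by (auto intro!: integrable_real_indicator simp: emeasure_eq_measure)
  then show "integrable M (\<lambda>x. c (T x))"
    by (subst Bochner_Integration.integrable_cong[OF refl eq]) auto
  have "(\<integral>x. c (T x) \<partial>M) = (\<Sum>s\<in>S. \<integral>x. indicator (T -` {s} \<inter> space M) x * c s \<partial>M)"
    using int by (subst Bochner_Integration.integral_cong[OF refl eq])
      (auto intro!: Bochner_Integration.integral_sum)
  also have "\<dots> = (\<Sum>s\<in>S. measure M (T -` {s} \<inter> space M) * c s)"
    using meas by (intro sum.cong) auto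
  finally show "(\<integral>x. c (T x) \<partial>M) = (\<Sum>s\<in>S. measure M (T -` {s} \<inter> space M) * c s)" .
qed

section \<open>Itineraries\<close>

definition partition_cell :: "'a set set \<Rightarrow> 'a \<Rightarrow> 'a set" where
  "partition_cell P x = (THE A. A \<in> P \<and> x \<in> A)"

text \<open>Restriction to \<open>{..<n}\<close> makes words extensional functions, so that over a
  finite alphabet there are only finitely many of length \<open>n\<close>.\<close>

definition itinerary :: "('a \<Rightarrow> 'a) \<Rightarrow> 'a set set \<Rightarrow> nat \<Rightarrow> 'a \<Rightarrow> nat \<Rightarrow> 'a set" where
  "itinerary f P n x = (\<lambda>i\<in>{..<n}. partition_cell P ((f ^^ i) x))"

lemma partition_cell_unique:
  assumes "partition_on UNIV P" "A \<in> P" "x \<in> A"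
  shows "partition_cell P x = A"
  unfolding partition_cell_def
proof (rule the_equality)
  fix B assume "B \<in> P \<and> x \<in> B"
  with assms show "B = A"
    by (auto simp: partition_on_def disjoint_def)
qed (use assms in auto)

lemma partition_cell:
  assumes "partition_on UNIV P"
  shows "partition_cell P x \<in> P" "x \<in> partition_cell P x"
proof -
  obtain A where "A \<in> P" "x \<in> A"
    using assms by (auto simp: partition_on_def)
  then show "partition_cell P x \<in> P" "x \<in> partition_cell P x"
    using partition_cell_unique[OF assms] by auto
qed

lemma itinerary_in_PiE:
  assumes "partition_on UNIV P"
  shows "itinerary f P n x \<in> {..<n} \<rightarrow>\<^sub>E P"
  using partition_cell[OF assms] by (auto simp: itinerary_def)

lemma itinerary_vimage:
  assumes "partition_on UNIV P" and "\<omega> \<in> {..<n} \<rightarrow>\<^sub>E P"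
  shows "itinerary f P n -` {\<omega>} = (\<Inter>i<n. (f ^^ i) -` \<omega> i)"
proof (intro set_eqI iffI)
  fix x assume "x \<in> itinerary f P n -` {\<omega>}"
  then have "\<omega> = itinerary f P n x" by auto
  then show "x \<in> (\<Inter>i<n. (f ^^ i) -` \<omega> i)"
    using partition_cell[OF assms(1)] by (auto simp: itinerary_def)
next
  fix x assume x: "x \<in> (\<Inter>i<n. (f ^^ i) -` \<omega> i)"
  have "itinerary f P n x i = \<omega> i" for i
  proof (cases "i < n")
    case True
    then have "\<omega> i \<in> P" "(f ^^ i) x \<in> \<omega> i"
      using assms(2) x by auto
    then show ?thesis
      using True partition_cell_unique[OF assms(1)] by (simp add: itinerary_def)
  next
    case False
    then show ?thesis
      using assms(2) by (auto simp: itinerary_def)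
  qed
  then show "x \<in> itinerary f P n -` {\<omega>}" by auto
qed

text \<open>The atoms of the join are the nonempty fibres of the itinerary map. A point of an atom
  forces every choice of a cell, so it is harmless that \<open>common_refinement\<close> sees a set
  of partitions, in which equal pullbacks for different \<open>i\<close> coincide.\<close>

lemma dynamical_join_eq:
  assumes P: "partition_on UNIV P"
  shows "dynamical_join f P n = (\<lambda>\<omega>. itinerary f P n -` {\<omega>}) ` range (itinerary f P n)"
proof -
  let ?Q = "\<lambda>i. (\<lambda>A. (f ^^ i) -` A) ` P"
  define R where "R x = (\<Inter>i<n. (f ^^ i) -` partition_cell P ((f ^^ i) x))" for x
  have R: "itinerary f P n -` {itinerary f P n x} = R x" for x
    using itinerary_vimage[OF P itinerary_in_PiE[OF P]] by (auto simp: R_def itinerary_def)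
  have cell: "B = (f ^^ i) -` partition_cell P ((f ^^ i) x)" if "B \<in> ?Q i" "x \<in> B" for B i x
    using that partition_cell_unique[OF P] by auto
  have "dynamical_join f P n = range R"
  proof (intro equalityI subsetI)
    fix X assume "X \<in> dynamical_join f P n"
    then obtain F x where F: "F \<in> (\<Pi> Q\<in>?Q ` {..<n}. Q)" and X: "X = \<Inter> (F ` ?Q ` {..<n})"
      and x: "x \<in> X"
      unfolding dynamical_join_def common_refinement by blast
    have "F (?Q i) = (f ^^ i) -` partition_cell P ((f ^^ i) x)" if "i < n" for i
      using that F X x by (intro cell) auto
    then have "X = R x"
      unfolding X R_def by auto
    then show "X \<in> range R" by simp
  next
    fix X assume "X \<in> range R"
    then obtain x where X: "X = R x" by auto
    \<comment> \<open>The choice depends on the partition \<open>Q\<close> and not on the index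
      \<open>i\<close>, as the definition of \<open>common_refinement\<close> requires.\<close>
    define F where "F Q = (SOME B. B \<in> Q \<and> x \<in> B)" for Q
    have F: "F (?Q i) \<in> ?Q i \<and> x \<in> F (?Q i)" for i
      unfolding F_def
      by (rule someI[of _ "(f ^^ i) -` partition_cell P ((f ^^ i) x)"]) (use partition_cell[OF P] in auto)
    then have "F (?Q i) = (f ^^ i) -` partition_cell P ((f ^^ i) x)" for i
      by (intro cell) auto
    then have "X = \<Inter> (F ` ?Q ` {..<n})"
      unfolding X R_def by auto
    moreover have "F \<in> (\<Pi> Q\<in>?Q ` {..<n}. Q)"
      using F by auto
    moreover have "x \<in> X"
      using partition_cell[OF P] by (auto simp: X R_def)
    ultimately show "X \<in> dynamical_join f P n"
      unfolding dynamical_join_def common_refinement by blast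
  qed
  then show ?thesis
    by (simp add: image_image R)
qed

text \<open>Words that never occur have empty cylinders and contribute \<open>0\<close>. The index
  set of all words is the one on which the comparison distributions for Gibbs' inequality
  live.\<close>

lemma partition_entropy_dynamical_join:
  assumes P: "partition_on UNIV P" and fin: "finite P"
  shows "partition_entropy \<mu> (dynamical_join f P n) =
    - (\<Sum>\<omega>\<in>{..<n} \<rightarrow>\<^sub>E P. measure \<mu> (itinerary f P n -` {\<omega>}) * ln (measure \<mu> (itinerary f P n -` {\<omega>})))"
proof -
  have "inj_on (\<lambda>\<omega>. itinerary f P n -` {\<omega>}) (range (itinerary f P n))"
    by (auto simp: inj_on_def)
  then have "partition_entropy \<mu> (dynamical_join f P n) =
    - (\<Sum>\<omega>\<in>range (itinerary f P n). measure \<mu> (itinerary f P n -` {\<omega>}) * ln (measure \<mu> (itinerary f P n -` {\<omega>})))"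
    unfolding partition_entropy_def dynamical_join_eq[OF P] by (simp add: sum.reindex)
  also have "(\<Sum>\<omega>\<in>range (itinerary f P n). measure \<mu> (itinerary f P n -` {\<omega>}) * ln (measure \<mu> (itinerary f P n -` {\<omega>})))
    = (\<Sum>\<omega>\<in>{..<n} \<rightarrow>\<^sub>E P. measure \<mu> (itinerary f P n -` {\<omega>}) * ln (measure \<mu> (itinerary f P n -` {\<omega>})))"
  proof (rule sum.mono_neutral_left)
    show "finite ({..<n} \<rightarrow>\<^sub>E P)"
      using fin by (intro finite_PiE) auto
    show "range (itinerary f P n) \<subseteq> {..<n} \<rightarrow>\<^sub>E P"
      using itinerary_in_PiE[OF P] by blast
    show "\<forall>\<omega>\<in>({..<n} \<rightarrow>\<^sub>E P) - range (itinerary f P n).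
      measure \<mu> (itinerary f P n -` {\<omega>}) * ln (measure \<mu> (itinerary f P n -` {\<omega>})) = 0"
    proof
      fix \<omega> assume "\<omega> \<in> ({..<n} \<rightarrow>\<^sub>E P) - range (itinerary f P n)"
      then have "itinerary f P n -` {\<omega>} = {}" by auto
      then show "measure \<mu> (itinerary f P n -` {\<omega>}) * ln (measure \<mu> (itinerary f P n -` {\<omega>})) = 0"
        by simp
    qed
  qed
  finally show ?thesis .
qed

section \<open>Entropy of the dynamical joins\<close>

locale partitioned_system = prob_space \<mu> for \<mu> :: "'a::metric_space measure" +
  fixes f :: "'a \<Rightarrow> 'a" and P :: "'a set set"
  assumes sets_eq: "sets \<mu> = sets borel" and f_measurable: "f \<in> borel_measurable borel"
    and invariant: "distr \<mu> borel f = \<mu>" and partition: "finite_measurable_partition P"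
begin

abbreviation words :: "nat \<Rightarrow> (nat \<Rightarrow> 'a set) set" where
  "words n \<equiv> {..<n} \<rightarrow>\<^sub>E P"

definition cylinder_prob :: "nat \<Rightarrow> (nat \<Rightarrow> 'a set) \<Rightarrow> real" where
  "cylinder_prob n \<omega> = prob (itinerary f P n -` {\<omega>})"

lemma space_eq: "space \<mu> = UNIV"
  using sets_eq_imp_space_eq[OF sets_eq] by simp

lemma P_facts: "finite P" "partition_on UNIV P" "\<And>A. A \<in> P \<Longrightarrow> A \<in> sets borel"
  using partition by (auto simp: finite_measurable_partition_def)

lemma finite_words: "finite (words n)"
  using P_facts by (intro finite_PiE) auto

lemma funpow_measurable: "f ^^ i \<in> borel_measurable borel"
  using f_measurable by (induction i) (auto intro: measurable_comp)

lemma funpow_vimage_sets: "A \<in> sets borel \<Longrightarrow> (f ^^ i) -` A \<in> sets borel"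
  using measurable_sets[OF funpow_measurable] by (metis Int_UNIV_right space_borel)

lemma prob_funpow_vimage:
  assumes "A \<in> sets borel"
  shows "prob ((f ^^ i) -` A) = prob A"
proof (induction i)
  case (Suc i)
  let ?B = "(f ^^ i) -` A"
  have f: "f \<in> measurable \<mu> borel"
    using f_measurable measurable_cong_sets[OF sets_eq refl] by auto
  have "(f ^^ Suc i) -` A = f -` ?B"
    by (simp only: funpow_Suc_right vimage_comp[symmetric])
  also have "prob (f -` ?B) = measure (distr \<mu> borel f) ?B"
    using measure_distr[OF f funpow_vimage_sets[OF assms]] by (simp add: space_eq)
  also have "\<dots> = prob ?B"
    by (simp add: invariant)
  finally show ?case using Suc by (rule trans)
qed simp

lemma cylinder_sets: "\<omega> \<in> words n \<Longrightarrow> itinerary f P n -` {\<omega>} \<in> sets borel"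
proof -
  assume \<omega>: "\<omega> \<in> words n"
  show ?thesis
  proof (cases "n = 0")
    case False
    then show ?thesis
      unfolding itinerary_vimage[OF P_facts(2) \<omega>]
      using \<omega> P_facts(3) funpow_vimage_sets by (intro sets.finite_INT) auto
  qed (use \<omega> in \<open>simp add: itinerary_vimage[OF P_facts(2)]\<close>)
qed

lemma
  fixes c :: "(nat \<Rightarrow> 'a set) \<Rightarrow> real"
  shows integrable_itinerary: "integrable \<mu> (\<lambda>x. c (itinerary f P n x))"
    and integral_itinerary: "(\<integral>x. c (itinerary f P n x) \<partial>\<mu>) = (\<Sum>\<omega>\<in>words n. cylinder_prob n \<omega> * c \<omega>)"
  using integral_finite_valued[OF finite_words, of "itinerary f P n" n c]
    itinerary_in_PiE[OF P_facts(2)] cylinder_sets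
  by (simp_all add: space_eq sets_eq cylinder_prob_def)

text \<open>By invariance, the itinerary read from time \<open>k\<close> on has the same law as the
  one read from time \<open>0\<close>.\<close>

lemma integral_itinerary_shift:
  fixes c :: "(nat \<Rightarrow> 'a set) \<Rightarrow> real"
  shows "integrable \<mu> (\<lambda>x. c (itinerary f P n ((f ^^ k) x)))"
    and "(\<integral>x. c (itinerary f P n ((f ^^ k) x)) \<partial>\<mu>) = (\<Sum>\<omega>\<in>words n. cylinder_prob n \<omega> * c \<omega>)"
proof -
  have vimage: "(\<lambda>x. itinerary f P n ((f ^^ k) x)) -` {\<omega>} = (f ^^ k) -` (itinerary f P n -` {\<omega>})" for \<omega>
    by auto
  show "integrable \<mu> (\<lambda>x. c (itinerary f P n ((f ^^ k) x)))"
    and "(\<integral>x. c (itinerary f P n ((f ^^ k) x)) \<partial>\<mu>) = (\<Sum>\<omega>\<in>words n. cylinder_prob n \<omega> * c \<omega>)"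
    using integral_finite_valued[OF finite_words, of "\<lambda>x. itinerary f P n ((f ^^ k) x)" n c]
      itinerary_in_PiE[OF P_facts(2)] cylinder_sets prob_funpow_vimage[OF cylinder_sets]
      funpow_vimage_sets[OF cylinder_sets]
    by (simp_all add: space_eq sets_eq cylinder_prob_def vimage)
qed

lemma sum_cylinder_prob: "(\<Sum>\<omega>\<in>words n. cylinder_prob n \<omega>) = 1"
  using integral_itinerary[of "\<lambda>_. 1" n] prob_space by (simp add: space_eq)

lemma cylinder_prob_nonneg: "0 \<le> cylinder_prob n \<omega>"
  by (simp add: cylinder_prob_def)

definition join_entropy :: "nat \<Rightarrow> real" where
  "join_entropy n = partition_entropy \<mu> (dynamical_join f P n)"

lemma join_entropy_eq: "join_entropy n = - (\<Sum>\<omega>\<in>words n. cylinder_prob n \<omega> * ln (cylinder_prob n \<omega>))"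
  unfolding join_entropy_def cylinder_prob_def
  by (rule partition_entropy_dynamical_join[OF P_facts(2,1)])

lemma join_entropy_nonneg: "0 \<le> join_entropy n"
proof -
  have "cylinder_prob n \<omega> * ln (cylinder_prob n \<omega>) \<le> 0" for \<omega>
    by (cases "cylinder_prob n \<omega> = 0")
      (auto simp: cylinder_prob_def zero_less_measure_iff intro!: mult_nonneg_nonpos)
  then show ?thesis
    unfolding join_entropy_eq by (simp add: sum_nonpos)
qed

text \<open>Gibbs' inequality, with the product of the laws of the prefix and of the suffix as
  comparison; by stationarity the suffix has the law of an initial word of length
  \<open>n\<close>.\<close>

lemma join_entropy_subadditive: "join_entropy (m + n) \<le> join_entropy m + join_entropy n"
proof -
  define pre :: "(nat \<Rightarrow> 'a set) \<Rightarrow> nat \<Rightarrow> 'a set" where "pre \<omega> = (\<lambda>i\<in>{..<m}. \<omega> i)" for \<omega>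
  define suf :: "(nat \<Rightarrow> 'a set) \<Rightarrow> nat \<Rightarrow> 'a set" where "suf \<omega> = (\<lambda>i\<in>{..<n}. \<omega> (m + i))" for \<omega>
  let ?q = "\<lambda>\<omega>. cylinder_prob m (pre \<omega>) * cylinder_prob n (suf \<omega>)"
  let ?W = "words (m + n)"
  have pre: "pre (itinerary f P (m + n) x) = itinerary f P m x" for x
    by (auto simp: pre_def itinerary_def restrict_def fun_eq_iff)
  have suf: "suf (itinerary f P (m + n) x) = itinerary f P n ((f ^^ m) x)" for x
    by (auto simp: suf_def itinerary_def fun_eq_iff add.commute[of m] funpow_add)
  \<comment> \<open>A word is recovered from its prefix and suffix, so the total mass of
    \<open>?q\<close> is at most that of the product distribution, namely \<open>1\<close>.\<close>
  have inj: "inj_on (\<lambda>\<omega>. (pre \<omega>, suf \<omega>)) ?W"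
  proof (rule inj_onI)
    fix \<omega> \<omega>' assume W: "\<omega> \<in> ?W" "\<omega>' \<in> ?W" and eq: "(pre \<omega>, suf \<omega>) = (pre \<omega>', suf \<omega>')"
    have "\<omega> i = \<omega>' i" if "i < m + n" for i
    proof (cases "i < m")
      case True
      then show ?thesis
        using eq by (auto simp: pre_def dest!: fun_cong[of _ _ i])
    next
      case False
      from eq have "suf \<omega> (i - m) = suf \<omega>' (i - m)" by simp
      moreover have "i - m < n" "m + (i - m) = i"
        using False that by auto
      ultimately show ?thesis
        by (simp add: suf_def)
    qed
    then show "\<omega> = \<omega>'"
      using W by (intro PiE_ext[OF W]) auto
  qed
  have "(\<Sum>\<omega>\<in>?W. ?q \<omega>) = (\<Sum>(\<alpha>, \<beta>)\<in>(\<lambda>\<omega>. (pre \<omega>, suf \<omega>)) ` ?W. cylinder_prob m \<alpha> * cylinder_prob n \<beta>)"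
    by (simp add: sum.reindex[OF inj])
  also have "\<dots> \<le> (\<Sum>(\<alpha>, \<beta>)\<in>words m \<times> words n. cylinder_prob m \<alpha> * cylinder_prob n \<beta>)"
    using finite_words cylinder_prob_nonneg
    by (intro sum_mono2) (auto simp: pre_def suf_def)
  also have "\<dots> = 1"
    by (simp add: sum.cartesian_product[symmetric] sum_distrib_left[symmetric] sum_cylinder_prob)
  finally have q_le: "(\<Sum>\<omega>\<in>?W. ?q \<omega>) \<le> 1" .
  \<comment> \<open>The cylinder of a word lies inside that of its prefix and inside the shifted
    cylinder of its suffix.\<close>
  have pos: "cylinder_prob m (pre \<omega>) > 0 \<and> cylinder_prob n (suf \<omega>) > 0"
    if \<omega>: "\<omega> \<in> ?W" "cylinder_prob (m + n) \<omega> > 0" for \<omega>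
  proof -
    have sets: "itinerary f P m -` {pre \<omega>} \<in> sets borel" "itinerary f P n -` {suf \<omega>} \<in> sets borel"
      using \<omega> by (auto intro!: cylinder_sets simp: pre_def suf_def)
    have "cylinder_prob (m + n) \<omega> \<le> cylinder_prob m (pre \<omega>)"
      unfolding cylinder_prob_def using sets pre by (intro finite_measure_mono) (auto simp: sets_eq)
    moreover have "cylinder_prob (m + n) \<omega> \<le> prob ((f ^^ m) -` (itinerary f P n -` {suf \<omega>}))"
      unfolding cylinder_prob_def using sets suf funpow_vimage_sets
      by (intro finite_measure_mono) (auto simp: sets_eq)
    then have "cylinder_prob (m + n) \<omega> \<le> cylinder_prob n (suf \<omega>)"
      using prob_funpow_vimage[OF sets(2)] by (simp add: cylinder_prob_def)
    ultimately show ?thesis using \<omega>(2) by linarith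
  qed
  have "join_entropy (m + n) \<le> - (\<Sum>\<omega>\<in>?W. cylinder_prob (m + n) \<omega> * ln (?q \<omega>))"
    unfolding join_entropy_eq using pos q_le
    by (intro gibbs_inequality finite_words) (auto simp: cylinder_prob_nonneg sum_cylinder_prob)
  \<comment> \<open>The logarithm splits only when both factors are positive; on all other words the
    weight in front is \<open>0\<close>.\<close>
  also have "(\<Sum>\<omega>\<in>?W. cylinder_prob (m + n) \<omega> * ln (?q \<omega>)) =
    (\<Sum>\<omega>\<in>?W. cylinder_prob (m + n) \<omega> * (ln (cylinder_prob m (pre \<omega>)) + ln (cylinder_prob n (suf \<omega>))))"
  proof (rule sum.cong[OF refl])
    fix \<omega> assume "\<omega> \<in> ?W"
    then show "cylinder_prob (m + n) \<omega> * ln (?q \<omega>) =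
      cylinder_prob (m + n) \<omega> * (ln (cylinder_prob m (pre \<omega>)) + ln (cylinder_prob n (suf \<omega>)))"
      using pos[of \<omega>] cylinder_prob_nonneg[of "m + n" \<omega>]
      by (cases "cylinder_prob (m + n) \<omega> = 0") (auto simp: ln_mult less_le)
  qed
  also have "\<dots> = (\<integral>x. ln (cylinder_prob m (itinerary f P m x)) +
      ln (cylinder_prob n (itinerary f P n ((f ^^ m) x))) \<partial>\<mu>)"
    by (subst integral_itinerary[symmetric]) (simp add: pre suf)
  also have "\<dots> = - (join_entropy m + join_entropy n)"
    using integrable_itinerary[of "\<lambda>\<omega>. ln (cylinder_prob m \<omega>)" m]
      integral_itinerary_shift[of "\<lambda>\<omega>. ln (cylinder_prob n \<omega>)" n m]
      integral_itinerary[of "\<lambda>\<omega>. ln (cylinder_prob m \<omega>)" m]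
    by (simp add: join_entropy_eq)
  finally show ?thesis by simp
qed

text \<open>The comparison distribution \<open>q\<close> in Gibbs' inequality is the law of a random word whose index \<open>j\<close>
  is uniform on \<open>{..<k}\<close> and whose letters independently follow the guess \<open>g j i\<close> up to a small error.\<close>

lemma join_entropy_predictable:
  fixes g :: "nat \<Rightarrow> nat \<Rightarrow> 'a set" and \<theta> \<eta> C :: real
  assumes g: "\<And>j i. g j i \<in> P" and E: "\<And>i. i < m \<Longrightarrow> E i \<in> sets borel" "\<And>i. i < m \<Longrightarrow> prob (E i) \<le> \<eta>"
    and pred: "\<And>x. \<exists>j<k. \<forall>i<m. x \<notin> E i \<longrightarrow> partition_cell P ((f ^^ i) x) = g j i"
    and \<theta>: "\<theta> > 0" and C: "C = - ln ((1 - exp (- \<theta>)) / real (card P))"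
  shows "join_entropy m \<le> ln (real k) + real m * (\<theta> + \<eta> * C)"
proof -
  \<comment> \<open>The mass \<open>1 - exp (- \<theta>)\<close> is spread evenly over the alphabet:
    a correct guess costs \<open>\<theta>\<close>, a wrong one costs
    \<open>C = - ln a\<close>.\<close>
  define a where "a = (1 - exp (- \<theta>)) / real (card P)"
  have "P \<noteq> {}" using g by blast
  then have card: "card P > 0" using P_facts by (simp add: card_gt_0_iff)
  have a: "0 < a" "a \<le> 1"
    using card \<theta> by (auto simp: a_def divide_simps) (smt (verit) exp_gt_zero of_nat_1 of_nat_mono Suc_leI One_nat_def)
  have C_eq: "ln a = - C" by (simp add: a_def C)
  have C_nonneg: "0 \<le> C" using a C_eq by (metis ln_le_zero_iff neg_le_0_iff_le)
  have k: "k > 0" using pred by (metis not_less_zero gr0I)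
  \<comment> \<open>The guessed letter receives no share \<open>a\<close> on top, so the total may
    fall below \<open>1\<close>; a subprobability is enough for Gibbs' inequality.\<close>
  define r where "r j i A = (if A = g j i then exp (- \<theta>) else a)" for j i A
  have r_pos: "r j i A > 0" for j i A
    using a by (simp add: r_def)
  have r_sum: "(\<Sum>A\<in>P. r j i A) \<le> 1" for j i
  proof -
    have "(\<Sum>A\<in>P. r j i A) = exp (- \<theta>) + (\<Sum>A\<in>P - {g j i}. a)"
      using g P_facts by (subst sum.remove[of _ "g j i"]) (auto simp: r_def)
    also have "\<dots> \<le> exp (- \<theta>) + (\<Sum>A\<in>P. a)"
      using a P_facts by (intro add_left_mono sum_mono2) auto
    also have "\<dots> = 1"
      using card by (simp add: a_def)
    finally show ?thesis .
  qed
  define q where "q \<omega> = (\<Sum>j<k. \<Prod>i<m. r j i (\<omega> i)) / real k" for \<omega>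
  have q_pos: "q \<omega> > 0" for \<omega>
    unfolding q_def using k r_pos by (auto intro!: divide_pos_pos sum_pos prod_pos)
  have "(\<Sum>\<omega>\<in>words m. q \<omega>) = (\<Sum>j<k. \<Sum>\<omega>\<in>words m. \<Prod>i<m. r j i (\<omega> i)) / real k"
    unfolding q_def by (subst sum.swap) (simp add: sum_divide_distrib)
  \<comment> \<open>Distributivity: for a fixed phase the letters are independent, so the sum over
    words factorises.\<close>
  also have "(\<Sum>j<k. \<Sum>\<omega>\<in>words m. \<Prod>i<m. r j i (\<omega> i)) = (\<Sum>j<k. \<Prod>i<m. \<Sum>A\<in>P. r j i A)"
    using P_facts by (subst prod_sum_PiE) auto
  also have "\<dots> \<le> (\<Sum>j<k. 1)"
    using r_sum r_pos by (intro sum_mono prod_le_1 conjI sum_nonneg) (auto simp: less_imp_le)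
  finally have q_le: "(\<Sum>\<omega>\<in>words m. q \<omega>) \<le> 1"
    using k by (simp add: divide_simps)
  \<comment> \<open>A code length: \<open>ln k\<close> to name the phase, \<open>\<theta>\<close>
    for each letter, and an extra \<open>C\<close> at each time where a mistake is allowed.\<close>
  have bound: "- ln (q (itinerary f P m x)) \<le> ln (real k) + (\<Sum>i<m. \<theta> + C * indicator (E i) x)" for x
  proof -
    obtain j where j: "j < k" "\<And>i. i < m \<Longrightarrow> x \<notin> E i \<Longrightarrow> partition_cell P ((f ^^ i) x) = g j i"
      using pred by blast
    let ?\<omega> = "itinerary f P m x"
    have letter: "- ln (r j i (?\<omega> i)) \<le> \<theta> + C * indicator (E i) x" if "i < m" for i
      using that j(2)[OF that] C_eq C_nonneg \<theta> by (auto simp: r_def itinerary_def indicator_def)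
    \<comment> \<open>Keeping only the phase that predicts \<open>x\<close> loses no more than the
      factor \<open>1 / k\<close>.\<close>
    have "(\<Prod>i<m. r j i (?\<omega> i)) / real k \<le> q ?\<omega>"
      unfolding q_def using j(1) r_pos
      by (intro divide_right_mono member_le_sum[of _ "{..<k}" "\<lambda>j. \<Prod>i<m. r j i (?\<omega> i)"])
        (auto intro!: prod_pos less_imp_le)
    then have "ln ((\<Prod>i<m. r j i (?\<omega> i)) / real k) \<le> ln (q ?\<omega>)"
      using q_pos k r_pos by (subst ln_le_cancel_iff) (auto intro!: divide_pos_pos prod_pos)
    also have "ln ((\<Prod>i<m. r j i (?\<omega> i)) / real k) = (\<Sum>i<m. ln (r j i (?\<omega> i))) - ln (real k)"
    proof -
      have "0 < (\<Prod>i<m. r j i (?\<omega> i))" using r_pos by (intro prod_pos) auto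
      moreover have "r j i A \<noteq> 0" for i A using r_pos[of j i A] by simp
      ultimately show ?thesis using k by (simp add: ln_div ln_prod)
    qed
    finally have "- ln (q ?\<omega>) \<le> ln (real k) + (\<Sum>i<m. - ln (r j i (?\<omega> i)))"
      by (simp add: sum_negf)
    also have "(\<Sum>i<m. - ln (r j i (?\<omega> i))) \<le> (\<Sum>i<m. \<theta> + C * indicator (E i) x)"
      using letter by (intro sum_mono) auto
    finally show ?thesis by simp
  qed
  have "join_entropy m \<le> - (\<Sum>\<omega>\<in>words m. cylinder_prob m \<omega> * ln (q \<omega>))"
    unfolding join_entropy_eq using q_pos q_le
    by (intro gibbs_inequality finite_words) (auto simp: cylinder_prob_nonneg sum_cylinder_prob less_imp_le)
  also have "\<dots> = (\<integral>x. - ln (q (itinerary f P m x)) \<partial>\<mu>)"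
    by (subst integral_itinerary[of "\<lambda>\<omega>. - ln (q \<omega>)"]) (simp add: sum_negf)
  also have "\<dots> \<le> (\<integral>x. ln (real k) + (\<Sum>i<m. \<theta> + C * indicator (E i) x) \<partial>\<mu>)"
    using bound E integrable_itinerary[of "\<lambda>\<omega>. - ln (q \<omega>)" m]
    by (intro integral_mono) (auto simp: sets_eq emeasure_eq_measure
        intro!: Bochner_Integration.integrable_sum Bochner_Integration.integrable_add integrable_real_indicator)
  also have "\<dots> = ln (real k) + (\<Sum>i<m. \<theta> + C * prob (E i))"
    using E(1) prob_space by (subst Bochner_Integration.integral_add)
      (auto simp: sets_eq space_eq emeasure_eq_measure Bochner_Integration.integral_sum
        intro!: Bochner_Integration.integrable_sum Bochner_Integration.integrable_add integrable_real_indicator)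
  also have "(\<Sum>i<m. \<theta> + C * prob (E i)) \<le> (\<Sum>i<m. \<theta> + C * \<eta>)"
    using E(2) C_nonneg by (intro sum_mono add_left_mono mult_left_mono) auto
  finally show ?thesis by (simp add: mult.commute)
qed

end

section \<open>Positive distance between disjoint compact sets\<close>

lemma compact_disjoint_separated:
  fixes S T :: "'a::metric_space set"
  assumes "compact S" "compact T" "S \<inter> T = {}"
  shows "\<exists>d>0. \<forall>x\<in>S. \<forall>y\<in>T. d \<le> dist x y"
proof (cases "S = {} \<or> T = {}")
  case False
  \<comment> \<open>The distance to \<open>T\<close> attains its minimum on the compact set
    \<open>S\<close>, and this minimum is positive because \<open>T\<close> is closed.\<close>
  then obtain a where a: "a \<in> S" "\<And>x. x \<in> S \<Longrightarrow> infdist a T \<le> infdist x T"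
    using continuous_attains_inf[OF assms(1), of "\<lambda>x. infdist x T"]
      continuous_on_infdist[OF continuous_on_id, of S T] by auto
  have "infdist a T > 0"
    using a assms False by (intro infdist_pos_not_in_closed) (auto intro: compact_imp_closed)
  moreover have "infdist a T \<le> dist x y" if "x \<in> S" "y \<in> T" for x y
    using a(2)[OF that(1)] infdist_le[OF that(2), of x] by linarith
  ultimately show ?thesis by blast
qed (auto intro: exI[of _ 1])

lemma compact_disjoint_family_separated:
  fixes K :: "'i \<Rightarrow> 'a::metric_space set"
  assumes "finite I" "\<And>i. i \<in> I \<Longrightarrow> compact (K i)" "disjoint_family_on K I"
  shows "\<exists>d>0. \<forall>i\<in>I. \<forall>j\<in>I. i \<noteq> j \<longrightarrow> (\<forall>x\<in>K i. \<forall>y\<in>K j. d \<le> dist x y)"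
proof -
  have "\<exists>d>0. i \<in> I \<longrightarrow> j \<in> I \<longrightarrow> i \<noteq> j \<longrightarrow> (\<forall>x\<in>K i. \<forall>y\<in>K j. d \<le> dist x y)" for i j
    using compact_disjoint_separated[of "K i" "K j"] assms
    by (cases "i \<in> I \<and> j \<in> I \<and> i \<noteq> j") (auto simp: disjoint_family_on_def intro: exI[of _ 1])
  then obtain d where d: "\<And>i j. d i j > 0"
    "\<And>i j x y. i \<in> I \<Longrightarrow> j \<in> I \<Longrightarrow> i \<noteq> j \<Longrightarrow> x \<in> K i \<Longrightarrow> y \<in> K j \<Longrightarrow> d i j \<le> dist x y"
    by metis
  \<comment> \<open>The element \<open>1\<close> keeps \<open>D\<close> nonempty when
    \<open>I\<close> is empty.\<close>
  define D where "D = insert (1::real) ((\<lambda>(i, j). d i j) ` (I \<times> I))"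
  have D: "finite D" "D \<noteq> {}"
    using assms by (auto simp: D_def)
  have "Min D > 0"
    using D d(1) by (subst Min_gr_iff) (auto simp: D_def)
  moreover have "Min D \<le> dist x y" if "i \<in> I" "j \<in> I" "i \<noteq> j" "x \<in> K i" "y \<in> K j" for i j x y
  proof -
    have "Min D \<le> d i j"
      using D that by (intro Min_le) (auto simp: D_def)
    then show ?thesis using d(2)[OF that] by linarith
  qed
  ultimately show ?thesis by blast
qed

section \<open>Shadowing periodic orbits\<close>

text \<open>The phase \<open>j\<close> lets a shadowing point start near any of the first
  \<open>k\<close> points of the orbit of \<open>x\<close>. Strict inequalities at finitely many
  times make the set open for continuous \<open>f\<close>.\<close>

definition shadowing_set :: "('a::metric_space \<Rightarrow> 'a) \<Rightarrow> 'a \<Rightarrow> nat \<Rightarrow> nat \<Rightarrow> real \<Rightarrow> 'a set" where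
  "shadowing_set f x k m d = {y. \<exists>j<k. \<forall>i<m. dist ((f ^^ i) y) ((f ^^ (i + j)) x) < d}"

lemma open_shadowing_set:
  assumes "continuous_on UNIV f"
  shows "open (shadowing_set f x k m d)"
proof -
  have f: "continuous_on UNIV (f ^^ i)" for i
  proof (induction i)
    case (Suc i)
    then show ?case
      using continuous_on_compose[of UNIV "f ^^ i" f] continuous_on_subset[OF assms] by simp
  qed (simp add: id_def)
  have "shadowing_set f x k m d = (\<Union>j<k. \<Inter>i<m. {y. dist ((f ^^ i) y) ((f ^^ (i + j)) x) < d})"
    by (auto simp: shadowing_set_def)
  moreover have "open {y. dist ((f ^^ i) y) ((f ^^ (i + j)) x) < d}" for i j
    by (intro open_Collect_less continuous_intros f)
  ultimately show ?thesis
    by (auto intro!: open_UN open_INT)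
qed

lemma orbit_in_shadowing_set:
  assumes "j < k" "d > 0"
  shows "(f ^^ j) x \<in> shadowing_set f x k m d"
  using assms by (auto simp: shadowing_set_def funpow_add)

lemma period_pos:
  assumes "periodic_point f x"
  shows "period f x > 0"
  using LeastI_ex[of "\<lambda>k. k > 0 \<and> (f ^^ k) x = x"] assms
  by (simp add: periodic_point_def period_def)

lemma orbit_measure_eq_1:
  assumes "periodic_point f x" "A \<in> sets borel" "\<And>j. j < period f x \<Longrightarrow> (f ^^ j) x \<in> A"
  shows "measure (orbit_measure f x) A = 1"
proof -
  have "emeasure (orbit_measure f x) A = of_nat (period f x) / of_nat (period f x)"
    using assms by (simp add: emeasure_orbit_measure)
  also have "\<dots> = 1"
    using period_pos[OF assms(1)] by (intro ennreal_divide_self) (auto simp: of_nat_less_top)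
  finally show ?thesis
    by (simp add: measure_def)
qed

section \<open>Small entropy from shadowing\<close>

context partitioned_system
begin

text \<open>Inner regularity shrinks each cell to a compact piece, and finitely many disjoint
  compact pieces are uniformly separated. Metric closeness then determines the letter, except on a
  set of small measure.\<close>

lemma compact_approx_partition:
  assumes "compact (UNIV :: 'a set)" and "\<eta> > 0"
  obtains K d where "\<And>A. A \<in> P \<Longrightarrow> compact (K A)" "\<And>A. A \<in> P \<Longrightarrow> K A \<subseteq> A"
    and "prob (UNIV - (\<Union>A\<in>P. K A)) < \<eta>" and "d > 0"
    and "\<And>A B x y. A \<in> P \<Longrightarrow> B \<in> P \<Longrightarrow> x \<in> K A \<Longrightarrow> y \<in> K B \<Longrightarrow> dist x y < d \<Longrightarrow> A = B"
proof -
  have UN: "\<Union>P = UNIV" and disj: "\<And>A B. A \<in> P \<Longrightarrow> B \<in> P \<Longrightarrow> A \<noteq> B \<Longrightarrow> A \<inter> B = {}"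
    using P_facts(2) by (auto simp: partition_on_def disjoint_def)
  then have card: "card P > 0"
    using P_facts(1) by (auto simp: card_gt_0_iff)
  \<comment> \<open>Each cell may lose \<open>\<eta> / card P\<close>, so all of them together lose
    less than \<open>\<eta>\<close>.\<close>
  have "\<exists>F. A \<in> P \<longrightarrow> closed F \<and> F \<subseteq> A \<and> prob (A - F) < \<eta> / card P" for A
  proof (cases "A \<in> P")
    case True
    then obtain F U where FU: "closed F" "open U" "F \<subseteq> A" "A \<subseteq> U" "prob (U - F) < \<eta> / card P"
      using borel_closed_open_approx[OF finite_measure_axioms sets_eq, of A "\<eta> / card P"]
        P_facts(3) card \<open>\<eta> > 0\<close> by auto
    then have "prob (A - F) \<le> prob (U - F)"
      by (intro finite_measure_mono) (auto simp: sets_eq)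
    then show ?thesis using FU by auto
  qed simp
  then obtain K where K: "\<And>A. A \<in> P \<Longrightarrow> closed (K A)" "\<And>A. A \<in> P \<Longrightarrow> K A \<subseteq> A"
    "\<And>A. A \<in> P \<Longrightarrow> prob (A - K A) < \<eta> / card P"
    by metis
  have compact: "compact (K A)" if "A \<in> P" for A
    using compact_Int_closed[OF assms(1) K(1)[OF that]] by simp
  have "UNIV - (\<Union>A\<in>P. K A) \<subseteq> (\<Union>A\<in>P. A - K A)"
    using UN by blast
  then have "prob (UNIV - (\<Union>A\<in>P. K A)) \<le> prob (\<Union>A\<in>P. A - K A)"
    using P_facts K(1) by (intro finite_measure_mono) (auto simp: sets_eq intro!: sets.finite_UN)
  also have "\<dots> \<le> (\<Sum>A\<in>P. prob (A - K A))"
    using P_facts K(1) by (intro finite_measure_subadditive_finite) (auto simp: sets_eq)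
  also have "\<dots> < (\<Sum>A\<in>P. \<eta> / card P)"
    using K(3) P_facts(1) card by (intro sum_strict_mono) auto
  finally have "prob (UNIV - (\<Union>A\<in>P. K A)) < \<eta>"
    using card by simp
  moreover have "disjoint_family_on K P"
    unfolding disjoint_family_on_def using K(2) disj by blast
  then obtain d where "d > 0" "\<forall>A\<in>P. \<forall>B\<in>P. A \<noteq> B \<longrightarrow> (\<forall>x\<in>K A. \<forall>y\<in>K B. d \<le> dist x y)"
    using compact_disjoint_family_separated[of P K] P_facts(1) compact by blast
  ultimately show ?thesis
    using that[OF compact K(2)] by (meson not_le)
qed

text \<open>Along a shadowing piece the itinerary is guessed from the phase alone, so
  \<open>join_entropy_predictable\<close> applies with one guess per phase and
  \<open>m = n * k\<close>.\<close>

lemma join_entropy_small: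
  assumes compact: "compact (UNIV :: 'a set)" and cont: "continuous_on UNIV f"
    and shadow: "\<And>n::nat. n > 0 \<Longrightarrow>
      \<exists>x k. k > 0 \<and> 1 - 1 / real n < prob (shadowing_set f x k (n * k) (1 / real n))"
    and "e > 0"
  shows "\<exists>m>0. join_entropy m \<le> e * real m"
proof -
  \<comment> \<open>The budget \<open>e\<close> per letter is split into three:
    \<open>\<theta>\<close> for correct guesses, \<open>2 * \<eta> * C\<close> for mistakes, and the
    phase. \<open>C\<close> depends only on \<open>\<theta>\<close> and \<open>card P\<close>, so
    \<open>\<eta>\<close>, \<open>d\<close> and \<open>n\<close> can be fixed before the
    orbit.\<close>
  define \<theta> where "\<theta> = e / 3"
  define C where "C = - ln ((1 - exp (- \<theta>)) / real (card P))"
  \<comment> \<open>A positive upper bound for \<open>C\<close>, safe to divide by.\<close>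
  define D where "D = \<bar>C\<bar> + 1"
  define \<eta> where "\<eta> = e / (6 * D)"
  have D: "D > 0" "C \<le> D"
    by (auto simp: D_def)
  have pos: "\<theta> > 0" "\<eta> > 0"
    using \<open>e > 0\<close> D by (auto simp: \<theta>_def \<eta>_def)
  obtain K d where K: "\<And>A. A \<in> P \<Longrightarrow> compact (K A)" "\<And>A. A \<in> P \<Longrightarrow> K A \<subseteq> A"
    and K_prob: "prob (UNIV - (\<Union>A\<in>P. K A)) < \<eta>" and "d > 0"
    and sep: "\<And>A B x y. A \<in> P \<Longrightarrow> B \<in> P \<Longrightarrow> x \<in> K A \<Longrightarrow> y \<in> K B \<Longrightarrow> dist x y < d \<Longrightarrow> A = B"
    using compact_approx_partition[OF compact pos(2)] by metis
  \<comment> \<open>The three bounds control the cost of the phase, the mass outside the shadowing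
    set, and the distance of two points that are both \<open>1 / n\<close>-close to the same orbit
    point.\<close>
  obtain N where "1 / real (Suc N) < min (e / 3) (min \<eta> (d / 2))"
    using nat_approx_posE[of "min (e / 3) (min \<eta> (d / 2))"] \<open>e > 0\<close> \<open>d > 0\<close> pos by auto
  then obtain n :: nat where n: "n > 0" "1 / real n < e / 3" "1 / real n < \<eta>" "1 / real n < d / 2"
    by (metis min_less_iff_conj zero_less_Suc)
  obtain x k where k: "k > 0" and V_prob: "1 - 1 / real n < prob (shadowing_set f x k (n * k) (1 / real n))"
    using shadow[OF n(1)] by blast
  define m where "m = n * k"
  define V where "V = shadowing_set f x k m (1 / real n)"
  define bad where "bad = UNIV - (\<Union>A\<in>P. K A)"
  \<comment> \<open>A mistake at time \<open>i\<close> is excused if the iterate misses all compact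
    pieces or if the point does not shadow at all; each event has measure below
    \<open>\<eta>\<close>, the first by invariance.\<close>
  define E where "E i = (f ^^ i) -` bad \<union> (UNIV - V)" for i
  have V: "V \<in> sets borel"
    unfolding V_def using open_shadowing_set[OF cont] by auto
  have bad: "bad \<in> sets borel"
    unfolding bad_def using K(1) P_facts(1)
    by (intro sets.Diff sets.finite_UN) (auto intro: borel_closed compact_imp_closed)
  have E_sets: "E i \<in> sets borel" for i
    unfolding E_def using V bad funpow_vimage_sets by (intro sets.Un sets.Diff) auto
  have E_prob: "prob (E i) \<le> 2 * \<eta>" for i
  proof -
    have "prob (E i) \<le> prob ((f ^^ i) -` bad) + prob (UNIV - V)"
      unfolding E_def using V bad funpow_vimage_sets
      by (intro measure_Un_le) (auto simp: sets_eq)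
    also have "prob ((f ^^ i) -` bad) = prob bad"
      by (rule prob_funpow_vimage[OF bad])
    also have "prob (UNIV - V) = 1 - prob V"
      using prob_compl[of V] V by (simp add: space_eq sets_eq)
    finally show ?thesis
      using K_prob V_prob n(3) by (simp add: bad_def V_def m_def)
  qed
  define near where "near A j i \<longleftrightarrow> (\<exists>z\<in>K A. dist z ((f ^^ (i + j)) x) < 1 / real n)" for A j i
  \<comment> \<open>The guess is a cell whose compact piece comes close to the orbit point, or an
    arbitrary cell if there is none.\<close>
  have "\<exists>A\<in>P. (\<exists>B\<in>P. near B j i) \<longrightarrow> near A j i" for j i
    using partition_cell(1)[OF P_facts(2)] by blast
  then obtain g where g: "\<And>j i. g j i \<in> P"
    and g_near: "\<And>j i A. A \<in> P \<Longrightarrow> near A j i \<Longrightarrow> near (g j i) j i"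
    by metis
  \<comment> \<open>Outside \<open>V\<close> every time is excused, so any phase serves, and
    \<open>k > 0\<close> provides one.\<close>
  have pred: "\<exists>j<k. \<forall>i<m. y \<notin> E i \<longrightarrow> partition_cell P ((f ^^ i) y) = g j i" for y
  proof (cases "y \<in> V")
    case True
    then obtain j where j: "j < k" "\<And>i. i < m \<Longrightarrow> dist ((f ^^ i) y) ((f ^^ (i + j)) x) < 1 / real n"
      by (auto simp: V_def shadowing_set_def)
    have "partition_cell P ((f ^^ i) y) = g j i" if i: "i < m" "y \<notin> E i" for i
    proof -
      obtain A where A: "A \<in> P" "(f ^^ i) y \<in> K A"
        using i(2) by (auto simp: E_def bad_def)
      then have "near A j i"
        using j(2)[OF i(1)] by (auto simp: near_def)
      then obtain z where z: "z \<in> K (g j i)" "dist z ((f ^^ (i + j)) x) < 1 / real n"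
        using g_near[OF A(1)] by (auto simp: near_def)
      \<comment> \<open>Both points are within \<open>1 / n < d / 2\<close> of the same orbit point,
        so separation forces their cells to agree.\<close>
      have "dist ((f ^^ i) y) z < d"
        using j(2)[OF i(1)] z(2) n(4) dist_triangle2[of "(f ^^ i) y" z "(f ^^ (i + j)) x"] by linarith
      then have "A = g j i"
        using sep A z(1) g by blast
      then show ?thesis
        using A K(2) partition_cell_unique[OF P_facts(2)] by blast
    qed
    then show ?thesis using j(1) by blast
  qed (use k in \<open>auto simp: E_def\<close>)
  have "join_entropy m \<le> ln (real k) + real m * (\<theta> + 2 * \<eta> * C)"
    using join_entropy_predictable[OF _ E_sets E_prob pred pos(1) C_def] g by simp
  \<comment> \<open>Here the length of the shadowing beats the period:
    \<open>ln k \<le> k = m / n\<close>.\<close>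
  moreover have "ln (real k) \<le> real m * (e / 3)"
  proof -
    have "ln (real k) \<le> real k"
      using ln_le_minus_one[of "real k"] k by simp
    also have "\<dots> = real m * (1 / real n)"
      using n(1) by (simp add: m_def)
    also have "\<dots> \<le> real m * (e / 3)"
      using n(2) by (intro mult_left_mono) auto
    finally show ?thesis .
  qed
  moreover have "2 * \<eta> * C \<le> e / 3"
  proof -
    have "2 * \<eta> * C \<le> 2 * \<eta> * D"
      using pos D by (intro mult_left_mono) auto
    also have "\<dots> = e / 3"
      using D by (simp add: \<eta>_def)
    finally show ?thesis .
  qed
  then have "real m * (\<theta> + 2 * \<eta> * C) \<le> real m * (e / 3 + e / 3)"
    unfolding \<theta>_def by (intro mult_left_mono) auto
  ultimately have "join_entropy m \<le> e * real m"
    by (simp add: algebra_simps)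
  then show ?thesis
    using n(1) k by (intro exI[of _ m]) (auto simp: m_def)
qed

lemma entropy_wrt_partition_eq_0:
  assumes "\<And>e. e > 0 \<Longrightarrow> \<exists>m>0. join_entropy m \<le> e * real m"
  shows "entropy_wrt_partition f \<mu> P = 0"
proof -
  have "(\<lambda>n. join_entropy n / real n) \<longlonglongrightarrow> 0"
    using join_entropy_nonneg join_entropy_subadditive assms
    by (rule subadditive_quotient_tendsto_0)
  then show ?thesis
    unfolding entropy_wrt_partition_def join_entropy_def by (rule limI)
qed

end

text \<open>The shadowing condition does not mention a partition, so a single sequence of conditions
  handles all finite partitions at once.\<close>

lemma metric_entropy_eq_0:
  fixes f :: "'a::metric_space \<Rightarrow> 'a"
  assumes compact: "compact (UNIV :: 'a set)" and cont: "continuous_on UNIV f"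
    and \<mu>: "\<mu> \<in> invariant_measures f"
    and shadow: "\<And>n::nat. n > 0 \<Longrightarrow>
      \<exists>x k. k > 0 \<and> 1 - 1 / real n < measure \<mu> (shadowing_set f x k (n * k) (1 / real n))"
  shows "metric_entropy f \<mu> = 0"
proof -
  have "entropy_wrt_partition f \<mu> P = 0" if "finite_measurable_partition P" for P
  proof -
    interpret prob_space \<mu>
      using \<mu> by (simp add: invariant_measures_def borel_prob_measures_def)
    interpret partitioned_system \<mu> f P
      using \<mu> that borel_measurable_continuous_onI[OF cont]
      by unfold_locales (auto simp: invariant_measures_def borel_prob_measures_def)
    show ?thesis
      using join_entropy_small[OF compact cont shadow] by (rule entropy_wrt_partition_eq_0)
  qed
  \<comment> \<open>A supremum over an empty family would be minus infinity in \<open>ereal\<close>;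
    the trivial partition rules this out.\<close>
  moreover have "finite_measurable_partition {UNIV :: 'a set}"
    by (auto simp: finite_measurable_partition_def partition_on_def disjoint_def)
  ultimately show ?thesis
    unfolding metric_entropy_def by (auto simp: zero_ereal_def intro!: SUP_eq_const)
qed

section \<open>Genericity of zero entropy\<close>

theorem theorem5p2:
  fixes f :: "'a::metric_space \<Rightarrow> 'a"
  assumes "compact (UNIV :: 'a set)"
    and "continuous_on UNIV f"
    and "\<exists>L. L-lipschitz_on UNIV f"
    and "invariant_topology f closure_of periodic_measures f = invariant_measures f"
  shows "residual_in (invariant_topology f) {\<mu> \<in> invariant_measures f. metric_entropy f \<mu> = 0}"
proof -
  let ?T = "invariant_topology f"
  define V where "V n x = shadowing_set f x (period f x) (n * period f x) (1 / real n)" for n x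
  \<comment> \<open>The union over periodic points may be uncountable, which openness tolerates;
    countability of the intersection comes from \<open>n\<close> alone.\<close>
  define G where "G n = (\<Union>x\<in>Collect (periodic_point f).
    invariant_measures f \<inter> {\<mu> \<in> borel_prob_measures. 1 - 1 / real n < measure \<mu> (V n x)})" for n
  have V: "open (V n x)" for n x
    unfolding V_def by (rule open_shadowing_set[OF assms(2)])
  have G_open: "openin ?T (G n)" for n
    unfolding G_def invariant_topology_def
    by (intro openin_Union) (auto intro!: openin_subtopology_Int2 openin_weak_topology_measure_gt V)
  \<comment> \<open>For \<open>n = 0\<close> the convention \<open>1 / 0 = 0\<close> would demand
    mass above \<open>1\<close>, so \<open>G 0\<close> is empty.\<close>
  have G_dense: "?T closure_of G n = topspace ?T" if "n > 0" for n
  proof -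
    have "topspace ?T \<inter> periodic_measures f \<subseteq> G n"
    proof
      fix \<mu> assume \<mu>: "\<mu> \<in> topspace ?T \<inter> periodic_measures f"
      then obtain x where x: "periodic_point f x" "\<mu> = orbit_measure f x"
        by (auto simp: periodic_measures_def)
      \<comment> \<open>Every point of the orbit shadows the orbit exactly, with its own position as
        phase.\<close>
      have "measure \<mu> (V n x) = 1"
        unfolding x(2) using x(1) V orbit_in_shadowing_set[of _ "period f x" "1 / real n"] that
        by (intro orbit_measure_eq_1) (auto simp: V_def)
      then show "\<mu> \<in> G n"
        using \<mu> x(1) that by (auto simp: G_def topspace_invariant_topology invariant_measures_def)
    qed
    \<comment> \<open>The closure depends only on the part of a set inside the space, so the
      inclusion on \<open>topspace ?T\<close> suffices.\<close>
    then have "?T closure_of periodic_measures f \<subseteq> ?T closure_of G n"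
      by (subst closure_of_restrict) (rule closure_of_mono)
    then show ?thesis
      using assms(4) closure_of_subset_topspace[of ?T "G n"] by (auto simp: topspace_invariant_topology)
  qed
  have zero: "metric_entropy f \<mu> = 0" if "\<mu> \<in> topspace ?T \<inter> (\<Inter>n\<in>{0<..}. G n)" for \<mu>
  proof (rule metric_entropy_eq_0[OF assms(1,2)])
    show "\<mu> \<in> invariant_measures f"
      using that by (simp add: topspace_invariant_topology)
    fix n :: nat assume "n > 0"
    then have "\<mu> \<in> G n" using that by auto
    then obtain x where x: "periodic_point f x" "1 - 1 / real n < measure \<mu> (V n x)"
      by (auto simp: G_def)
    then show "\<exists>x k. k > 0 \<and> 1 - 1 / real n < measure \<mu> (shadowing_set f x k (n * k) (1 / real n))"
      using period_pos[OF x(1)] x(2) unfolding V_def by (intro exI conjI)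
  qed
  show ?thesis
    unfolding residual_in_def
  proof (intro conjI exI[of _ "G ` {0<..}"] ballI)
    show "topspace ?T \<inter> \<Inter> (G ` {0<..}) \<subseteq> {\<mu> \<in> invariant_measures f. metric_entropy f \<mu> = 0}"
      using zero topspace_invariant_topology by blast
  next
    fix U assume "U \<in> G ` {0<..}"
    then show "openin ?T U" "?T closure_of U = topspace ?T"
      using G_open G_dense by auto
  qed (auto simp: topspace_invariant_topology)
qed

end
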